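(* Let $S=k[x_1,\ldots,x_n]$ be a polynomial ring over a field $k$. Let $I=(L(u,v))\subset S$ be a lexsegment edge ideal which is neither an initial nor a final squarefree lexsegment ideal and is determined by $u=x_1x_i$ and $v=x_jx_r$ ($1<i\le n$, $1\le j<r\le n$). Then $\dim(S/I)=n-j$.
   Context: Monomials are ordered by the lexicographic order with $x_1>x_2>\cdots>x_n$. For squarefree monomials $u\geq_{lex}v$ of degree $2$, $L(u,v)=\{w: w \text{ a squarefree monomial of degree } 2,\ u\geq_{lex}w\geq_{lex}v\}$, and the ideal $(L(u,v))$ is called the lexsegment edge ideal determined by $u,v$. It is initial if $u=x_1x_2$ and final if $v=x_{n-1}x_n$. $\dim$ denotes Krull dimension. *)

theory Defs
  imports
    "HOL-Library.Poly_Mapping"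
    "HOL-Library.Extended_Nat"
    "HOL-Algebra.QuotRing"
begin

section \<open>The polynomial ring in \<open>x\<^sub>1, \<dots>, x\<^sub>n\<close>\<close>

text \<open>A monomial is its exponent vector, of type \<open>nat \<Rightarrow>\<^sub>0 nat\<close>, and a polynomial is a finitely
  supported family of coefficients indexed by monomials; multiplication of polynomials is the
  convolution product of \<^theory>\<open>HOL-Library.Poly_Mapping\<close>.  Products of monomials are sums
  of exponent vectors.\<close>

type_synonym mon = "nat \<Rightarrow>\<^sub>0 nat"
type_synonym 'k mpol = "mon \<Rightarrow>\<^sub>0 'k"

definition monomials_upto :: "nat \<Rightarrow> mon set" where
  "monomials_upto n = {m. Poly_Mapping.keys m \<subseteq> {1..n}}"

definition mpoly_ring :: "nat \<Rightarrow> ('k::field) mpol ring" where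
  "mpoly_ring n =
    \<lparr>carrier = {p. Poly_Mapping.keys p \<subseteq> monomials_upto n},
     mult = (*), one = 1, zero = 0, add = (+)\<rparr>"

definition mon_var :: "nat \<Rightarrow> mon" where
  "mon_var i = Poly_Mapping.single i 1"

definition poly_of_mon :: "mon \<Rightarrow> ('k::field) mpol" where
  "poly_of_mon m = Poly_Mapping.single m 1"

lemma cring_mpoly_ring: "cring (mpoly_ring n :: ('k::field) mpol ring)"
proof -
  let ?C = "{p :: 'k mpol. Poly_Mapping.keys p \<subseteq> monomials_upto n}"
  have mon_add: "a + b \<in> monomials_upto n"
    if "a \<in> monomials_upto n" "b \<in> monomials_upto n" for a b
    using that Poly_Mapping.keys_add[of a b] by (auto simp: monomials_upto_def)
  have add: "p + q \<in> ?C" if "p \<in> ?C" "q \<in> ?C" for p q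
    using that Poly_Mapping.keys_add[of p q] by auto
  have mult: "p * q \<in> ?C" if "p \<in> ?C" "q \<in> ?C" for p q
    using that Poly_Mapping.keys_mult[of p q] mon_add by blast
  have one: "1 \<in> ?C"
    by (auto simp: monomials_upto_def simp flip: single_one)
  have neg: "- p \<in> ?C" if "p \<in> ?C" for p
    using that by simp
  show ?thesis
  proof (rule cringI)
    show "abelian_group (mpoly_ring n :: 'k mpol ring)"
    proof (rule abelian_groupI)
      fix x :: "'k mpol" assume "x \<in> carrier (mpoly_ring n)"
      then show "\<exists>y\<in>carrier (mpoly_ring n). y \<oplus>\<^bsub>mpoly_ring n\<^esub> x = \<zero>\<^bsub>mpoly_ring n\<^esub>"
        using neg by (intro bexI[of _ "- x"]) (auto simp: mpoly_ring_def)
    qed (use add in \<open>auto simp: mpoly_ring_def add_ac\<close>)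
    show "comm_monoid (mpoly_ring n :: 'k mpol ring)"
      by (rule comm_monoidI) (use mult one in \<open>auto simp: mpoly_ring_def mult_ac\<close>)
  qed (auto simp: mpoly_ring_def distrib_right)
qed

section \<open>Krull dimension\<close>

text \<open>The supremum of the lengths \<open>l\<close> of strictly ascending chains \<open>P 0 \<subset> \<dots> \<subset> P l\<close> of prime
  ideals.  The zero ring has no prime ideals; with values in \<^typ>\<open>enat\<close> its dimension is \<open>0\<close>.\<close>

definition krull_dim :: "('a, 'b) ring_scheme \<Rightarrow> enat" where
  "krull_dim R =
    (SUP l \<in> {l. \<exists>P. (\<forall>i\<le>l. primeideal (P i) R) \<and> (\<forall>i<l. P i \<subset> P (Suc i))}. enat l)"

section \<open>Lexsegment edge ideals\<close>

definition squarefree_monomials :: "nat \<Rightarrow> nat \<Rightarrow> mon set" where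
  "squarefree_monomials n d =
    {m \<in> monomials_upto n. (\<forall>i. Poly_Mapping.lookup m i \<le> 1) \<and>
      (\<Sum>i = 1..n. Poly_Mapping.lookup m i) = d}"

text \<open>The library order on \<^typ>\<open>mon\<close> compares exponents at the first index where they differ,
  so it is the lexicographic order with \<open>x\<^sub>1 > x\<^sub>2 > \<dots> > x\<^sub>n\<close>.\<close>

lemma mon_less_iff:
  "(u :: mon) < v \<longleftrightarrow>
    (\<exists>k. Poly_Mapping.lookup u k < Poly_Mapping.lookup v k \<and>
      (\<forall>l<k. Poly_Mapping.lookup u l = Poly_Mapping.lookup v l))"
  by (simp add: less_poly_mapping.rep_eq less_fun_def)

definition lexsegment :: "nat \<Rightarrow> mon \<Rightarrow> mon \<Rightarrow> mon set" where
  "lexsegment n u v = {w \<in> squarefree_monomials n 2. u \<ge> w \<and> w \<ge> v}"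

definition lexsegment_edge_ideal :: "nat \<Rightarrow> mon \<Rightarrow> mon \<Rightarrow> ('k::field) mpol set" where
  "lexsegment_edge_ideal n u v = Idl\<^bsub>mpoly_ring n\<^esub> (poly_of_mon ` lexsegment n u v)"

text \<open>The monomials \<open>u\<close> and \<open>v\<close> are the largest and the smallest element of \<open>L(u,v)\<close>,
  so being initial or final is a condition on \<open>u\<close> or \<open>v\<close> alone.\<close>

definition initial_lexsegment :: "mon \<Rightarrow> bool" where
  "initial_lexsegment u \<longleftrightarrow> u = mon_var 1 + mon_var 2"

definition final_lexsegment :: "nat \<Rightarrow> mon \<Rightarrow> bool" where
  "final_lexsegment n v \<longleftrightarrow> v = mon_var (n - 1) + mon_var n"

end

theory Submission
  imports Defs
begin

text \<open>Chains of primes of \<open>S/I\<close> are chains of primes of \<open>S\<close> that contain \<open>I\<close>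
  (\<open>krull_dim_Quot\<close>), so two bounds are needed.

  Lower bound.  Every monomial of \<open>L(u,v)\<close> is at least \<open>v = x\<^sub>j x\<^sub>r\<close> and hence is divisible by one of
  \<open>x\<^sub>1, \<dots>, x\<^sub>j\<close>.  So \<open>I\<close> lies in \<open>(x\<^sub>1, \<dots>, x\<^sub>j)\<close>, and adjoining \<open>x\<^bsub>j+1\<^esub>, \<dots>, x\<^sub>n\<close> one at a time
  gives a chain of length \<open>n - j\<close>.

  Upper bound.  Let \<open>P\<^sub>0 \<subset> \<dots> \<subset> P\<^sub>l\<close> be primes containing \<open>I\<close>, and let \<open>V\<close> be the set of indices of the
  variables outside \<open>P\<^sub>0\<close>.  As \<open>P\<^sub>0\<close> is prime, no product \<open>x\<^sub>a x\<^sub>b\<close> with distinct \<open>a, b \<in> V\<close> belongs to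
  \<open>L(u,v)\<close>: \<open>V\<close> is an independent set of the graph whose edges are the generators, and a case
  distinction on which of \<open>1, \<dots>, j\<close> belong to \<open>V\<close> shows that it has at most \<open>n - j\<close> elements
  (\<open>card_independent_le\<close>).  It remains to see that \<open>l \<le> card V\<close> (\<open>chain_length_le\<close>), which is the
  bound for the dimension of a polynomial ring in \<open>card V\<close> variables over a field.

  That bound has a short elementary proof.  Choose \<open>y\<^sub>i \<in> P\<^bsub>i+1\<^esub> - P\<^sub>i\<close> for \<open>i < l\<close>.  Modulo \<open>P\<^sub>0\<close> the
  products of powers of \<open>y\<^sub>0, \<dots>, y\<^bsub>l-1\<^esub>\<close> are linearly independent
  (\<open>chain_power_products_independent\<close>): in a nontrivial relation, take out the lowest power of
  \<open>y\<^sub>0\<close>, which may be cancelled modulo \<open>P\<^sub>0\<close>, and pass to \<open>P\<^sub>1\<close>, where only the terms free of \<open>y\<^sub>0\<close>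
  survive; after \<open>l\<close> rounds a nonzero constant lies in \<open>P\<^sub>l\<close>.  On the other hand the \<open>y\<^sub>i\<close> may be taken
  to involve only the variables indexed by \<open>V\<close>.  Then \<open>N\<^sup>l\<close> independent products with exponents
  below \<open>N\<close> live in a space whose dimension grows at most like a constant times \<open>N\<close> to the power
  \<open>card V\<close>, which is impossible for large \<open>N\<close> unless \<open>l \<le> card V\<close>.\<close>

section \<open>Prime ideals of a quotient ring\<close>

text \<open>Taking images and preimages under the projection is a bijection between ideals of the quotient
  and ideals above \<open>I\<close>.  What has to be added is that primes correspond to primes: a coset
  that meets a prime above \<open>I\<close> is contained in it.\<close>

lemma (in cring) krull_dim_Quot:
  assumes I: "ideal I R"
  shows "krull_dim (R Quot I) =
    (SUP l \<in> {l. \<exists>P. (\<forall>i\<le>l. primeideal (P i) R \<and> I \<subseteq> P i) \<and> (\<forall>i<l. P i \<subset> P (Suc i))}. enat l)"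
proof -
  interpret I: ideal I R by fact
  interpret h: ring_hom_cring R "R Quot I" "(+>) I"
    by (rule I.rcos_ring_hom_cring[OF is_cring])
  have surj: "(+>) I ` carrier R = carrier (R Quot I)"
    unfolding FactRing_def A_RCOSETS_def' by auto
  have image_prime: "primeideal ((+>) I ` P) (R Quot I)" if P: "primeideal P R" "I \<subseteq> P" for P
  proof -
    interpret P: primeideal P R by fact
    have mem: "x \<in> P" if "x \<in> carrier R" "I +> x \<in> (+>) I ` P" for x
    proof -
      from that(2) obtain p where p: "I +> x = I +> p" "p \<in> P" by (rule imageE)
      have "x \<in> I +> p" using I.a_rcos_self[OF that(1)] p(1) by simp
      then obtain t where "t \<in> I" "x = t \<oplus> p" by (auto simp: a_r_coset_def')
      then show ?thesis using p P.a_closed P(2) by auto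
    qed
    show ?thesis
    proof (rule primeidealI)
      show "ideal ((+>) I ` P) (R Quot I)"
        using ring_ideal_imp_quot_ideal[OF I P.is_ideal] .
      show "cring (R Quot I)" by (rule I.quotient_is_cring[OF is_cring])
      show "carrier (R Quot I) \<noteq> (+>) I ` P"
      proof
        assume eq: "carrier (R Quot I) = (+>) I ` P"
        have "I +> \<one> \<in> (+>) I ` P" unfolding eq[symmetric] by (rule h.hom_closed[OF one_closed])
        from mem[OF one_closed this] show False using P.one_imp_carrier P.I_notcarr by simp
      qed
      fix a b assume "a \<in> carrier (R Quot I)" "b \<in> carrier (R Quot I)"
        and ab: "a \<otimes>\<^bsub>R Quot I\<^esub> b \<in> (+>) I ` P"
      then obtain x y where xy: "x \<in> carrier R" "y \<in> carrier R" "a = I +> x" "b = I +> y"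
        unfolding surj[symmetric] by blast
      have "I +> (x \<otimes> y) \<in> (+>) I ` P"
        using ab unfolding xy(3,4) h.hom_mult[OF xy(1,2)] .
      from mem[OF m_closed[OF xy(1,2)] this] have "x \<otimes> y \<in> P" .
      then show "a \<in> (+>) I ` P \<or> b \<in> (+>) I ` P" using P.I_prime xy by blast
    qed
  qed
  have "{l. \<exists>P. (\<forall>i\<le>l. primeideal (P i) (R Quot I)) \<and> (\<forall>i<l. P i \<subset> P (Suc i))} =
      {l. \<exists>P. (\<forall>i\<le>l. primeideal (P i) R \<and> I \<subseteq> P i) \<and> (\<forall>i<l. P i \<subset> P (Suc i))}"
    (is "?A = ?B")
  proof (intro equalityI subsetI)
    fix l assume "l \<in> ?A"
    then obtain Q where Q: "\<And>i. i \<le> l \<Longrightarrow> primeideal (Q i) (R Quot I)"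
      and strict: "\<And>i. i < l \<Longrightarrow> Q i \<subset> Q (Suc i)" by auto
    define P where "P = (\<lambda>i. {r \<in> carrier R. I +> r \<in> Q i})"
    have Q_ideal: "ideal (Q i) (R Quot I)" if "i \<le> l" for i
      using Q[OF that] by (rule primeideal.axioms(1))
    have "primeideal (P i) R \<and> I \<subseteq> P i" if "i \<le> l" for i
    proof
      show "primeideal (P i) R"
        unfolding P_def 
        by (rule ring_hom_ring.primeideal_vimage[OF I.rcos_ring_hom_ring is_cring Q[OF that]])
      have "I \<in> Q i"
        using additive_subgroup.zero_closed[OF ideal.axioms(1)[OF Q_ideal[OF that]]]
        unfolding FactRing_def by simp
      then show "I \<subseteq> P i" using I.a_rcos_const I.a_subset by (auto simp: P_def)
    qed
    moreover have "P i \<subset> P (Suc i)" if i: "i < l" for i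
    proof -
      obtain q where q: "q \<in> Q (Suc i)" "q \<notin> Q i" using strict[OF i] by auto
      have "q \<in> carrier (R Quot I)"
        using ideal.Icarr[OF Q_ideal q(1)] i by simp
      then obtain r where "r \<in> carrier R" "q = I +> r" unfolding surj[symmetric] by (rule imageE)
      then have "r \<in> P (Suc i) - P i" using q by (simp add: P_def)
      then show ?thesis using strict[OF i] by (auto simp: P_def)
    qed
    ultimately show "l \<in> ?B" by auto
  next
    fix l assume "l \<in> ?B"
    then obtain P where P: "\<And>i. i \<le> l \<Longrightarrow> primeideal (P i) R" "\<And>i. i \<le> l \<Longrightarrow> I \<subseteq> P i"
      and strict: "\<And>i. i < l \<Longrightarrow> P i \<subset> P (Suc i)" by auto
    have "(+>) I ` P i \<subset> (+>) I ` P (Suc i)" if "i < l" for i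
    proof -
      have "P k \<in> {J. ideal J R \<and> I \<subseteq> J}" if "k \<le> l" for k
        using P[OF that] primeideal.axioms(1) by blast
      from this[of i] this[of "Suc i"] have "(+>) I ` P i \<noteq> (+>) I ` P (Suc i)"
        using strict[OF that] that
          inj_on_contraD[OF bij_betw_imp_inj_on[OF quot_ideal_correspondence[OF I]], of "P i" "P (Suc i)"]
        by simp
      moreover have "(+>) I ` P i \<subseteq> (+>) I ` P (Suc i)"
        by (rule image_mono) (use strict[OF that] in simp)
      ultimately show ?thesis by simp
    qed
    then show "l \<in> ?A"
      using image_prime P by (intro CollectI exI[of _ "\<lambda>i. (+>) I ` P i"]) auto
  qed
  then show ?thesis unfolding krull_dim_def by simp
qed

section \<open>Chains of primes and algebraic independence\<close>

lemma polys_closed: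
  fixes p q :: "('k::field) mpol"
  shows "0 \<in> carrier (mpoly_ring n :: 'k mpol ring)"
    and "1 \<in> carrier (mpoly_ring n :: 'k mpol ring)"
    and "Poly_Mapping.single 0 c \<in> carrier (mpoly_ring n :: 'k mpol ring)"
    and "p \<in> carrier (mpoly_ring n) \<Longrightarrow> q \<in> carrier (mpoly_ring n) \<Longrightarrow> p + q \<in> carrier (mpoly_ring n)"
    and "p \<in> carrier (mpoly_ring n) \<Longrightarrow> q \<in> carrier (mpoly_ring n) \<Longrightarrow> p * q \<in> carrier (mpoly_ring n)"
    and "p \<in> carrier (mpoly_ring n) \<Longrightarrow> p ^ e \<in> carrier (mpoly_ring n)"
proof -
  interpret cring "mpoly_ring n :: 'k mpol ring" by (rule cring_mpoly_ring)
  show "0 \<in> carrier (mpoly_ring n :: 'k mpol ring)"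
    and one: "1 \<in> carrier (mpoly_ring n :: 'k mpol ring)"
    using zero_closed one_closed by (simp_all add: mpoly_ring_def)
  show "Poly_Mapping.single 0 c \<in> carrier (mpoly_ring n :: 'k mpol ring)"
    by (simp add: mpoly_ring_def monomials_upto_def)
  show "p \<in> carrier (mpoly_ring n) \<Longrightarrow> q \<in> carrier (mpoly_ring n) \<Longrightarrow> p + q \<in> carrier (mpoly_ring n)"
    using a_closed[of p q] by (simp add: mpoly_ring_def)
  have mult: "p \<in> carrier (mpoly_ring n) \<Longrightarrow> q \<in> carrier (mpoly_ring n) \<Longrightarrow> p * q \<in> carrier (mpoly_ring n)" for p q :: "'k mpol"
    using m_closed[of p q] by (simp add: mpoly_ring_def)
  then show "p \<in> carrier (mpoly_ring n) \<Longrightarrow> q \<in> carrier (mpoly_ring n) \<Longrightarrow> p * q \<in> carrier (mpoly_ring n)" .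
  show "p \<in> carrier (mpoly_ring n) \<Longrightarrow> p ^ e \<in> carrier (mpoly_ring n)"
    using one mult by (induction e) auto
qed

lemma
  fixes P :: "('k::field) mpol set"
  assumes P: "primeideal P (mpoly_ring n)"
  shows prime_carrier: "p \<in> P \<Longrightarrow> p \<in> carrier (mpoly_ring n)"
    and prime_zero: "0 \<in> P"
    and prime_add: "p \<in> P \<Longrightarrow> q \<in> P \<Longrightarrow> p + q \<in> P"
    and prime_mult: "p \<in> P \<Longrightarrow> q \<in> carrier (mpoly_ring n) \<Longrightarrow> p * q \<in> P"
    and prime_diff: "p \<in> P \<Longrightarrow> q \<in> P \<Longrightarrow> p - q \<in> P"
    and prime_const: "c \<noteq> 0 \<Longrightarrow> Poly_Mapping.single 0 c \<notin> P"
    and prime_cancel: "p * q \<in> P \<Longrightarrow> p \<in> carrier (mpoly_ring n) \<Longrightarrow> q \<in> carrier (mpoly_ring n)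
      \<Longrightarrow> p \<in> P \<or> q \<in> P"
    and prime_power: "p \<in> carrier (mpoly_ring n) \<Longrightarrow> p ^ e \<in> P \<Longrightarrow> p \<in> P"
proof -
  interpret P: primeideal P "mpoly_ring n :: 'k mpol ring" by fact
  show carr: "p \<in> P \<Longrightarrow> p \<in> carrier (mpoly_ring n)" for p by (rule P.Icarr)
  show "0 \<in> P" using additive_subgroup.zero_closed[OF P.is_additive_subgroup]
    unfolding mpoly_ring_def by simp
  show add: "p \<in> P \<Longrightarrow> q \<in> P \<Longrightarrow> p + q \<in> P" for p q
    using additive_subgroup.a_closed[OF P.is_additive_subgroup, of p q] by (simp add: mpoly_ring_def)
  show mult: "p \<in> P \<Longrightarrow> q \<in> carrier (mpoly_ring n) \<Longrightarrow> p * q \<in> P" for p q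
    using P.I_r_closed[of p q] by (simp add: mpoly_ring_def)
  show "p - q \<in> P" if "p \<in> P" "q \<in> P"
  proof -
    have "q * Poly_Mapping.single 0 (- 1) \<in> P" using mult[OF that(2) polys_closed(3)] .
    then have "- q \<in> P" by (simp add: single_uminus)
    from add[OF that(1) this] show ?thesis by simp
  qed
  have one: "1 \<notin> P"
    using P.one_imp_carrier P.I_notcarr by (auto simp: mpoly_ring_def)
  show "Poly_Mapping.single 0 c \<notin> P" if "c \<noteq> 0"
  proof
    assume "Poly_Mapping.single 0 c \<in> P"
    from mult[OF this polys_closed(3), of "inverse c"] that one show False
      by (simp add: mult_single)
  qed
  show cancel: "p * q \<in> P \<Longrightarrow> p \<in> carrier (mpoly_ring n) \<Longrightarrow> q \<in> carrier (mpoly_ring n)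
      \<Longrightarrow> p \<in> P \<or> q \<in> P" for p q
    using P.I_prime[of p q] by (simp add: mpoly_ring_def)
  show "p \<in> carrier (mpoly_ring n) \<Longrightarrow> p ^ e \<in> P \<Longrightarrow> p \<in> P"
    using one by (induction e) (auto dest: cancel intro: polys_closed)
qed

lemma prime_sum:
  assumes P: "primeideal P (mpoly_ring n :: ('k::field) mpol ring)"
    and "\<And>a. a \<in> A \<Longrightarrow> f a \<in> P"
  shows "sum f A \<in> P"
  using assms(2) by (induction A rule: infinite_finite_induct)
    (auto intro: prime_zero[OF P] prime_add[OF P])

text \<open>The recursion consumes \<open>y 0\<close> first because the independence proof moves up the chain by one
  prime for each factor that it removes.\<close>

fun power_product :: "(nat \<Rightarrow> 'a::comm_ring_1) \<Rightarrow> nat list \<Rightarrow> 'a" where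
  "power_product y [] = 1"
| "power_product y (a # as) = y 0 ^ a * power_product (\<lambda>i. y (Suc i)) as"

lemma power_product_closed:
  fixes y :: "nat \<Rightarrow> ('k::field) mpol"
  assumes "\<And>i. i < length a \<Longrightarrow> y i \<in> carrier (mpoly_ring n)"
  shows "power_product y a \<in> carrier (mpoly_ring n)"
  using assms
proof (induction a arbitrary: y)
  case (Cons a as)
  have "power_product (\<lambda>i. y (Suc i)) as \<in> carrier (mpoly_ring n)"
    by (rule Cons.IH) (use Cons.prems in simp)
  then show ?case using Cons.prems[of 0] by (simp add: polys_closed)
qed (simp add: polys_closed)

text \<open>Induction on the length of the chain.  Among the exponents of \<open>y 0\<close> let \<open>e\<close> be the smallest.
  As \<open>y 0 \<notin> P 0\<close>, the factor \<open>y 0 ^ e\<close> can be cancelled modulo the prime \<open>P 0\<close>.  As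
  \<open>y 0 \<in> P 1\<close>, the terms in which \<open>y 0\<close> still occurs vanish modulo \<open>P 1\<close>, and the remaining ones form
  a relation for the chain that starts at \<open>P 1\<close>.\<close>

lemma chain_power_products_independent:
  fixes P :: "nat \<Rightarrow> ('k::field) mpol set"
  assumes "\<And>i. i \<le> l \<Longrightarrow> primeideal (P i) (mpoly_ring n)"
    and "\<And>i. i < l \<Longrightarrow> P i \<subseteq> P (Suc i)"
    and "\<And>i. i < l \<Longrightarrow> y i \<in> P (Suc i) - P i"
    and "finite A" and "\<And>a. a \<in> A \<Longrightarrow> length a = l" and "\<And>a. a \<in> A \<Longrightarrow> c a \<noteq> 0"
    and "(\<Sum>a\<in>A. Poly_Mapping.single 0 (c a) * power_product y a) \<in> P 0"
  shows "A = {}"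
  using assms
proof (induction l arbitrary: P y A c)
  case 0
  show ?case
  proof (rule ccontr)
    assume "A \<noteq> {}"
    then have "A = {[]}" using 0(5) by auto
    then show False using 0(6,7) prime_const[OF 0(1)] by auto
  qed
next
  case (Suc l)
  show ?case
  proof (rule ccontr)
    assume "A \<noteq> {}"
    define y' where "y' = (\<lambda>i. y (Suc i))"
    define e where "e = Min (hd ` A)"
    define A0 where "A0 = {a \<in> A. hd a = e}"
    have e: "e \<in> hd ` A" "\<And>a. a \<in> A \<Longrightarrow> e \<le> hd a"
      unfolding e_def using \<open>A \<noteq> {}\<close> Suc.prems(4) by auto
    have cons: "a = hd a # tl a" if "a \<in> A" for a using Suc.prems(5)[OF that] by (cases a) auto
    have P0: "primeideal (P 0) (mpoly_ring n)" and P1: "primeideal (P 1) (mpoly_ring n)"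
      using Suc.prems(1) by auto
    have y0: "y 0 \<in> P 1" "y 0 \<notin> P 0" using Suc.prems(3)[of 0] by auto
    have yc: "y i \<in> carrier (mpoly_ring n)" if "i < Suc l" for i
      using Suc.prems(3)[OF that] prime_carrier[OF Suc.prems(1)[of "Suc i"]] that by auto
    have y'c: "power_product y' (tl a) \<in> carrier (mpoly_ring n)" if "a \<in> A" for a
      by (rule power_product_closed) (use yc Suc.prems(5)[OF that] in \<open>auto simp: y'_def\<close>)
    \<comment> \<open>the terms after division by \<open>y 0 ^ e\<close>\<close>
    define t where "t = (\<lambda>a. Poly_Mapping.single 0 (c a) * (y 0 ^ (hd a - e) * power_product y' (tl a)))"
    have tc: "t a \<in> carrier (mpoly_ring n)" if "a \<in> A" for a
      unfolding t_def using that by (intro polys_closed y'c yc) auto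
    have sum_tc: "sum t B \<in> carrier (mpoly_ring n)" if "B \<subseteq> A" for B
      using that by (induction B rule: infinite_finite_induct) (auto intro: polys_closed tc)
    have "Poly_Mapping.single 0 (c a) * power_product y a = y 0 ^ e * t a" if "a \<in> A" for a
    proof -
      have "power_product y a = y 0 ^ hd a * power_product y' (tl a)"
        by (subst cons[OF that]) (simp add: y'_def)
      also have "y 0 ^ hd a = y 0 ^ e * y 0 ^ (hd a - e)"
        using e(2)[OF that] by (simp flip: power_add)
      finally show ?thesis by (simp add: t_def mult_ac)
    qed
    then have "y 0 ^ e * sum t A \<in> P 0"
      using Suc.prems(7) by (simp add: sum_distrib_left cong: sum.cong)
    then have "sum t A \<in> P 0"
      using prime_cancel[OF P0] prime_power[OF P0] y0 yc sum_tc polys_closed(6) by blast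
    then have "sum t A \<in> P 1" using Suc.prems(2)[of 0] by auto
    moreover have "sum t (A - A0) \<in> P 1"
    proof (rule prime_sum[OF P1])
      fix a assume a: "a \<in> A - A0"
      then have "e < hd a" using e(2)[of a] by (auto simp: A0_def)
      then have "y 0 ^ (hd a - e) = y 0 * y 0 ^ (hd a - e - 1)"
        by (simp add: power_eq_if)
      then have "t a = y 0 * (Poly_Mapping.single 0 (c a) * (y 0 ^ (hd a - e - 1) * power_product y' (tl a)))"
        unfolding t_def by (simp add: mult_ac)
      also have "\<dots> \<in> P 1"
        using a by (intro prime_mult[OF P1] y0 polys_closed y'c yc) auto
      finally show "t a \<in> P 1" .
    qed
    moreover have "sum t A = sum t A0 + sum t (A - A0)"
      using Suc.prems(4) sum.subset_diff[of A0 A t] by (auto simp: A0_def add.commute)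
    ultimately have "sum t A0 \<in> P 1" using prime_diff[OF P1, of "sum t A" "sum t (A - A0)"] by simp
    moreover have inj: "inj_on tl A0"
    proof (rule inj_onI)
      fix a b assume "a \<in> A0" "b \<in> A0" "tl a = tl b"
      then show "a = b" using cons[of a] cons[of b] by (simp add: A0_def)
    qed
    have "sum t A0 = (\<Sum>b\<in>tl ` A0. Poly_Mapping.single 0 (c (e # b)) * power_product y' b)"
      unfolding sum.reindex[OF inj] o_def
    proof (rule sum.cong[OF refl])
      fix a assume "a \<in> A0"
      then have "hd a = e" "a = e # tl a" using cons[of a] by (auto simp: A0_def)
      then show "t a = Poly_Mapping.single 0 (c (e # tl a)) * power_product y' (tl a)"
        unfolding t_def by simp
    qed
    ultimately have sum_P1: "(\<Sum>b\<in>tl ` A0. Poly_Mapping.single 0 (c (e # b)) * power_product y' b) \<in> P (Suc 0)"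
      by simp
    have "tl ` A0 = {}"
    proof (rule Suc.IH[where P = "\<lambda>i. P (Suc i)" and y = y' and c = "\<lambda>b. c (e # b)"])
      show "c (e # b) \<noteq> 0" if "b \<in> tl ` A0" for b
        using that cons Suc.prems(6) by (force simp: A0_def)
      show "length b = l" if "b \<in> tl ` A0" for b
        using that Suc.prems(5) by (auto simp: A0_def)
    qed (use Suc.prems(1-4) sum_P1 in \<open>auto simp: y'_def A0_def\<close>)
    then show False using e(1) by (auto simp: A0_def)
  qed
qed

text \<open>Stated for families, not sets, so that a repetition among the values also counts as a linear
  relation; the injectivity of the family is then a consequence of independence.\<close>

lemma card_independent_family_le:
  fixes f :: "'i \<Rightarrow> ('k::field) mpol"
  assumes T: "finite T" "\<And>a. a \<in> X \<Longrightarrow> Poly_Mapping.keys (f a) \<subseteq> T"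
    and indep: "\<And>A c. finite A \<Longrightarrow> A \<subseteq> X \<Longrightarrow> (\<And>a. a \<in> A \<Longrightarrow> c a \<noteq> 0) \<Longrightarrow>
      (\<Sum>a\<in>A. Poly_Mapping.single 0 (c a) * f a) = 0 \<Longrightarrow> A = {}"
  shows "card X \<le> card T"
proof -
  define scale :: "'k \<Rightarrow> 'k mpol \<Rightarrow> 'k mpol" where "scale = (\<lambda>c p. Poly_Mapping.single 0 c * p)"
  interpret vector_space scale
    by standard (simp_all add: scale_def algebra_simps single_add mult_single flip: mult.assoc)
  have inj: "inj_on f X"
  proof (rule inj_onI, rule ccontr)
    fix a b assume ab: "a \<in> X" "b \<in> X" "f a = f b" "a \<noteq> b"
    have "{a, b} = {}"
      by (rule indep[where c = "\<lambda>x. if x = a then 1 else - 1"])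
        (use ab in \<open>auto simp: single_uminus\<close>)
    then show False by simp
  qed
  have "independent (f ` X)"
    unfolding dependent_explicit
  proof (clarify)
    fix t u v assume t: "finite t" "t \<subseteq> f ` X" "(\<Sum>v\<in>t. scale (u v) v) = 0" "v \<in> t" "u v \<noteq> 0"
    define A where "A = {a \<in> X. f a \<in> t \<and> u (f a) \<noteq> 0}"
    have injA: "inj_on f A" using inj by (rule inj_on_subset) (auto simp: A_def)
    have fA: "f ` A = {w \<in> t. u w \<noteq> 0}" using t(2) by (auto simp: A_def)
    then have "finite A" using t(1) finite_imageD[OF _ injA] by simp
    have "(\<Sum>a\<in>A. Poly_Mapping.single 0 (u (f a)) * f a) = (\<Sum>w\<in>f ` A. scale (u w) w)"
      unfolding sum.reindex[OF injA] by (simp add: scale_def)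
    also have "\<dots> = (\<Sum>w\<in>t. scale (u w) w)"
      by (rule sum.mono_neutral_left) (use t(1) in \<open>auto simp: fA scale_def\<close>)
    finally have "A = {}" using t(3) \<open>finite A\<close>
      by (intro indep[where c = "\<lambda>a. u (f a)"]) (auto simp: A_def)
    then show False using fA t(4,5) by auto
  qed
  moreover have "f ` X \<subseteq> span ((\<lambda>m. Poly_Mapping.single m 1) ` T)"
  proof clarify
    fix a assume "a \<in> X"
    have "f a = (\<Sum>m\<in>Poly_Mapping.keys (f a). scale (Poly_Mapping.lookup (f a) m) (Poly_Mapping.single m 1))"
      by (rule poly_mapping_eqI)
        (auto simp: lookup_sum scale_def mult_single lookup_single when_def in_keys_iff)
    also have "\<dots> \<in> span ((\<lambda>m. Poly_Mapping.single m 1) ` T)"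
      using T(2)[OF \<open>a \<in> X\<close>] by (intro span_sum span_scale span_base) auto
    finally show "f a \<in> span ((\<lambda>m. Poly_Mapping.single m 1) ` T)" .
  qed
  ultimately have "card (f ` X) \<le> card ((\<lambda>m. Poly_Mapping.single m (1 :: 'k)) ` T)"
    using independent_span_bound T(1) by blast
  also have "\<dots> \<le> card T" using card_image_le[OF T(1)] .
  finally show ?thesis by (simp add: card_image[OF inj])
qed

section \<open>Setting variables to zero\<close>

text \<open>The substitution \<open>x\<^sub>i = 0\<close> for all \<open>i \<in> W\<close>.\<close>

definition kill :: "nat set \<Rightarrow> ('k::field) mpol \<Rightarrow> 'k mpol" where
  "kill W p = Poly_Mapping.mapp (\<lambda>m c. c when Poly_Mapping.keys m \<inter> W = {}) p"

lemma lookup_kill: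
  "Poly_Mapping.lookup (kill W p) m = (Poly_Mapping.lookup p m when Poly_Mapping.keys m \<inter> W = {})"
  by (simp add: kill_def lookup_mapp when_def in_keys_iff)

lemma keys_kill: "Poly_Mapping.keys (kill W p) = {m \<in> Poly_Mapping.keys p. Poly_Mapping.keys m \<inter> W = {}}"
  by (rule Set.set_eqI)
    (simp add: in_keys_iff[where s = "kill W p"] in_keys_iff[where s = p] lookup_kill conj_commute)

lemma keys_mon_add: "Poly_Mapping.keys ((a :: mon) + b) = Poly_Mapping.keys a \<union> Poly_Mapping.keys b"
  by (auto simp: in_keys_iff lookup_add)

lemma kill_add: "kill W (p + q) = kill W p + kill W q"
  by (rule poly_mapping_eqI) (simp add: lookup_kill lookup_add when_def)

lemma kill_eq_self: "(\<And>m. m \<in> Poly_Mapping.keys p \<Longrightarrow> Poly_Mapping.keys m \<inter> W = {}) \<Longrightarrow> kill W p = p"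
  by (rule poly_mapping_eqI) (auto simp: lookup_kill when_def in_keys_iff)

lemma kill_eq_0_iff: "kill W p = 0 \<longleftrightarrow> (\<forall>m\<in>Poly_Mapping.keys p. Poly_Mapping.keys m \<inter> W \<noteq> {})"
  using keys_kill[of W p] by (metis (mono_tags, lifting) empty_Collect_eq keys_eq_empty)

text \<open>A product in which one factor is killed is killed, since multiplying monomials only adds
  variables.  So both factors may be replaced by their surviving parts, whose product has no
  variable in \<open>W\<close> and survives unchanged.\<close>

lemma kill_mult: "kill W (p * q) = kill W p * kill W q"
proof -
  have dead: "kill W (r * s) = 0" if "kill W r = 0" for r s :: "'a mpol"
    using that keys_mult[of r s] by (fastforce simp: kill_eq_0_iff keys_mon_add)
  have rest: "kill W (r - kill W r) = 0" for r :: "'a mpol"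
    by (rule poly_mapping_eqI) (simp add: lookup_kill lookup_minus when_def)
  have "p * q = kill W p * kill W q + (p - kill W p) * q + (q - kill W q) * kill W p"
    by (simp add: algebra_simps)
  then have "kill W (p * q) = kill W (kill W p * kill W q)"
    by (simp add: kill_add dead rest)
  also have "\<dots> = kill W p * kill W q"
    using keys_mult[of "kill W p" "kill W q"]
    by (intro kill_eq_self) (fastforce simp: keys_kill keys_mon_add)
  finally show ?thesis .
qed

text \<open>For \<open>W \<subseteq> {1..n}\<close>, the ideal generated by the \<open>x\<^sub>i\<close> with \<open>i \<in> W\<close>.  Written as the kernel of a substitution
  it is prime because the polynomials form an integral domain.\<close>

definition variable_prime :: "nat \<Rightarrow> nat set \<Rightarrow> ('k::field) mpol set" where
  "variable_prime n W = {p \<in> carrier (mpoly_ring n). kill W p = 0}"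

lemma primeideal_variable_prime:
  "primeideal (variable_prime n W :: ('k::field) mpol set) (mpoly_ring n)"
proof (rule primeidealI2)
  interpret cring "mpoly_ring n :: 'k mpol ring" by (rule cring_mpoly_ring)
  show "cring (mpoly_ring n :: 'k mpol ring)" by (rule is_cring)
  have ops: "a \<oplus>\<^bsub>mpoly_ring n\<^esub> b = a + b" "a \<otimes>\<^bsub>mpoly_ring n\<^esub> b = a * b"
    "\<zero>\<^bsub>mpoly_ring n\<^esub> = (0 :: 'k mpol)" for a b :: "'k mpol"
    by (simp_all add: mpoly_ring_def)
  have kill_0: "kill W 0 = (0 :: 'k mpol)" by (simp add: kill_eq_0_iff)
  have kill_1: "kill W 1 = (1 :: 'k mpol)" by (rule kill_eq_self) simp
  show "additive_subgroup (variable_prime n W :: 'k mpol set) (mpoly_ring n)"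
  proof (intro additive_subgroup.intro add.subgroupI)
    show "\<ominus>\<^bsub>mpoly_ring n\<^esub> a \<in> variable_prime n W" if "a \<in> variable_prime n W" for a :: "'k mpol"
    proof -
      have a: "a \<in> carrier (mpoly_ring n)" "kill W a = 0" using that by (auto simp: variable_prime_def)
      then have "kill W (\<ominus>\<^bsub>mpoly_ring n\<^esub> a + a) = 0"
        using l_neg[OF a(1)] by (simp add: ops kill_0)
      then show ?thesis using a by (simp add: variable_prime_def kill_add)
    qed
    show "variable_prime n W \<noteq> ({} :: 'k mpol set)"
      using kill_0 polys_closed(1) by (auto simp: variable_prime_def)
  qed (auto simp: variable_prime_def ops kill_add polys_closed)
  show "carrier (mpoly_ring n) \<noteq> (variable_prime n W :: 'k mpol set)"
  proof
    assume "carrier (mpoly_ring n) = (variable_prime n W :: 'k mpol set)"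
    then have "(1 :: 'k mpol) \<in> variable_prime n W" using polys_closed(2) by blast
    then show False using kill_1 by (simp add: variable_prime_def)
  qed
  fix a b :: "'k mpol"
  assume b: "b \<in> carrier (mpoly_ring n)"
  {
    assume "a \<in> variable_prime n W"
    then show "b \<otimes>\<^bsub>mpoly_ring n\<^esub> a \<in> variable_prime n W"
      and "a \<otimes>\<^bsub>mpoly_ring n\<^esub> b \<in> variable_prime n W"
      using b by (simp_all add: ops variable_prime_def kill_mult polys_closed)
  next
    assume "a \<in> carrier (mpoly_ring n)" "a \<otimes>\<^bsub>mpoly_ring n\<^esub> b \<in> variable_prime n W"
    then show "a \<in> variable_prime n W \<or> b \<in> variable_prime n W"
      using b by (simp add: ops variable_prime_def kill_mult)
  }
qed

section \<open>Bounding the length of a chain\<close>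

definition box :: "nat set \<Rightarrow> nat \<Rightarrow> mon set" where
  "box V B = {m. Poly_Mapping.keys m \<subseteq> V \<and> (\<forall>x. Poly_Mapping.lookup m x \<le> B)}"

lemma
  assumes V: "finite V"
  shows finite_box: "finite (box V B)" and card_box_le: "card (box V B) \<le> (B + 1) ^ card V"
proof -
  let ?f = "\<lambda>m :: mon. restrict (Poly_Mapping.lookup m) V"
  have inj: "inj_on ?f (box V B)"
  proof (rule inj_onI, rule poly_mapping_eqI)
    fix m m' x assume m: "m \<in> box V B" "m' \<in> box V B" "?f m = ?f m'"
    show "Poly_Mapping.lookup m x = Poly_Mapping.lookup m' x"
    proof (cases "x \<in> V")
      case True
      then show ?thesis using fun_cong[OF m(3), of x] by simp
    next
      case False
      then have "x \<notin> Poly_Mapping.keys m" "x \<notin> Poly_Mapping.keys m'"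
        using m(1,2) by (auto simp: box_def)
      then show ?thesis by (simp add: not_in_keys_iff_lookup_eq_zero)
    qed
  qed
  have sub: "?f ` box V B \<subseteq> V \<rightarrow>\<^sub>E {..B}" by (auto simp: box_def)
  have fin: "finite (V \<rightarrow>\<^sub>E {..B})" using V by (intro finite_PiE) auto
  show "finite (box V B)" using finite_imageD[OF finite_subset[OF sub fin] inj] .
  have "card (box V B) \<le> card (V \<rightarrow>\<^sub>E {..B})" by (rule card_inj_on_le[OF inj sub fin])
  then show "card (box V B) \<le> (B + 1) ^ card V" by (simp add: card_PiE V)
qed

lemma box_mono: "B \<le> B' \<Longrightarrow> box V B \<subseteq> box V B'"
  by (auto simp: box_def intro: order_trans)

lemma keys_mult_box:
  assumes "Poly_Mapping.keys p \<subseteq> box V B" "Poly_Mapping.keys q \<subseteq> box V B'"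
  shows "Poly_Mapping.keys (p * q) \<subseteq> box V (B + B')"
proof -
  have "a + b \<in> box V (B + B')" if "a \<in> box V B" "b \<in> box V B'" for a b
    using that by (auto simp: box_def keys_mon_add lookup_add intro: add_mono)
  then show ?thesis using keys_mult[of p q] assms by blast
qed

lemma keys_power_box:
  "Poly_Mapping.keys p \<subseteq> box V D \<Longrightarrow> Poly_Mapping.keys (p ^ e) \<subseteq> box V (e * D)"
proof (induction e)
  case (Suc e)
  then show ?case using keys_mult_box[of p V D "p ^ e" "e * D"] by simp
qed (simp add: box_def)

lemma keys_power_product_box:
  "(\<And>i. i < length a \<Longrightarrow> Poly_Mapping.keys (y i) \<subseteq> box V D) \<Longrightarrow>
    Poly_Mapping.keys (power_product y a) \<subseteq> box V (sum_list a * D)"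
proof (induction a arbitrary: y)
  case (Cons e a)
  have "Poly_Mapping.keys (power_product (\<lambda>i. y (Suc i)) a) \<subseteq> box V (sum_list a * D)"
    by (rule Cons.IH) (use Cons.prems in simp)
  moreover have "Poly_Mapping.keys (y 0 ^ e) \<subseteq> box V (e * D)"
    using Cons.prems[of 0] by (intro keys_power_box) simp
  ultimately show ?case
    using keys_mult_box[of "y 0 ^ e" V "e * D"] by (simp add: distrib_right)
qed (simp add: box_def)

text \<open>Each monomial of such a polynomial is divisible by a variable that lies in \<open>P\<close>.\<close>

lemma prime_contains_killed:
  fixes P :: "('k::field) mpol set"
  assumes P: "primeideal P (mpoly_ring n)"
    and W: "\<And>i. i \<in> W \<Longrightarrow> poly_of_mon (mon_var i) \<in> P"
    and p: "p \<in> carrier (mpoly_ring n)" "kill W p = 0"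
  shows "p \<in> P"
proof -
  have "p = (\<Sum>m\<in>Poly_Mapping.keys p. Poly_Mapping.single m (Poly_Mapping.lookup p m))"
    by (rule poly_mapping_eqI) (auto simp: lookup_sum lookup_single when_def in_keys_iff)
  also have "\<dots> \<in> P"
  proof (rule prime_sum[OF P])
    fix m assume m: "m \<in> Poly_Mapping.keys p"
    then obtain i where i: "i \<in> Poly_Mapping.keys m" "i \<in> W" using p(2) by (auto simp: kill_eq_0_iff)
    define m' where "m' = m - mon_var i"
    have m': "m = mon_var i + m'"
      unfolding m'_def
      by (rule poly_mapping_eqI)
        (use i(1) in \<open>auto simp: lookup_add lookup_minus mon_var_def lookup_single when_def in_keys_iff\<close>)
    have "Poly_Mapping.keys m \<subseteq> {1..n}"
      using m p(1) by (auto simp: mpoly_ring_def monomials_upto_def)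
    then have "Poly_Mapping.keys m' \<subseteq> {1..n}" by (subst (asm) m') (simp add: keys_mon_add)
    then have "Poly_Mapping.single m' (Poly_Mapping.lookup p m) \<in> carrier (mpoly_ring n)"
      by (auto simp: mpoly_ring_def monomials_upto_def)
    from prime_mult[OF P W[OF i(2)] this]
    show "Poly_Mapping.single m (Poly_Mapping.lookup p m) \<in> P"
      by (simp add: poly_of_mon_def mult_single flip: m')
  qed
  finally show ?thesis .
qed

text \<open>If \<open>D\<close> bounds the exponents in the \<open>y\<^sub>i\<close>, then the \<open>N\<^sup>l\<close> independent power products with
  exponents below \<open>N\<close> are spanned by the monomials with exponents at most \<open>l N D\<close> in the variables
  indexed by \<open>V\<close>, and for \<open>card V < l\<close> and large \<open>N\<close> there are not enough of these.\<close>

lemma chain_length_le: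
  fixes P :: "nat \<Rightarrow> ('k::field) mpol set"
  assumes V: "V \<subseteq> {1..n}"
    and prime: "\<And>i. i \<le> l \<Longrightarrow> primeideal (P i) (mpoly_ring n)"
    and strict: "\<And>i. i < l \<Longrightarrow> P i \<subset> P (Suc i)"
    and vars: "\<And>i. i \<in> {1..n} - V \<Longrightarrow> poly_of_mon (mon_var i) \<in> P 0"
  shows "l \<le> card V"
proof (rule ccontr)
  assume "\<not> l \<le> card V"
  then have less: "card V < l" by simp
  have finV: "finite V" using V finite_subset by blast
  define W where "W = {1..n} - V"
  have P0: "P 0 \<subseteq> P i" if "i \<le> l" for i
    using that
  proof (induction i)
    case (Suc i)
    then show ?case using strict[of i] by auto
  qed simp
  have "\<exists>y. y \<in> P (Suc i) - P i" if "i < l" for i using strict[OF that] by blast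
  then obtain y where y: "\<And>i. i < l \<Longrightarrow> y i \<in> P (Suc i) - P i" by metis
  \<comment> \<open>setting to zero the variables that already lie in \<open>P 0\<close> changes \<open>y i\<close> by an element of \<open>P 0\<close> only\<close>
  define z where "z = (\<lambda>i. kill W (y i))"
  have keys_z: "Poly_Mapping.keys m \<subseteq> V" if "i < l" "m \<in> Poly_Mapping.keys (z i)" for i m
  proof -
    have "y i \<in> carrier (mpoly_ring n)"
      using y[OF that(1)] that(1) prime_carrier[OF prime[of "Suc i"]] by auto
    then show ?thesis
      using that(2) by (auto simp: z_def keys_kill W_def mpoly_ring_def monomials_upto_def)
  qed
  have z: "z i \<in> P (Suc i) - P i" if "i < l" for i
  proof -
    have pr: "primeideal (P (Suc i)) (mpoly_ring n)" "primeideal (P i) (mpoly_ring n)"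
      using prime that by auto
    have yc: "y i \<in> carrier (mpoly_ring n)" using y[OF that] prime_carrier[OF pr(1)] by auto
    have "y i - z i \<in> P 0"
    proof (rule prime_contains_killed[OF prime])
      show "kill W (y i - z i) = 0"
        by (rule poly_mapping_eqI) (simp add: z_def lookup_kill lookup_minus when_def)
      show "y i - z i \<in> carrier (mpoly_ring n)"
        using yc keys_diff[of "y i" "z i"] keys_kill[of W "y i"] by (auto simp: mpoly_ring_def z_def)
    qed (use vars W_def in auto)
    then have d: "y i - z i \<in> P i" "y i - z i \<in> P (Suc i)" using P0 that by (auto simp: subset_eq)
    show ?thesis
      using y[OF that] prime_diff[OF pr(1) _ d(2), of "y i"] prime_add[OF pr(2) d(1), of "z i"] by auto
  qed
  define D where "D = Max (insert 0 (\<Union>i<l. \<Union>m\<in>Poly_Mapping.keys (z i). Poly_Mapping.lookup m ` V))"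
  have box_z: "Poly_Mapping.keys (z i) \<subseteq> box V D" if "i < l" for i
  proof
    fix m assume m: "m \<in> Poly_Mapping.keys (z i)"
    have "Poly_Mapping.lookup m x \<le> D" for x
    proof (cases "x \<in> V")
      case True
      then show ?thesis unfolding D_def using that m finV by (intro Max_ge) auto
    next
      case False
      then have "x \<notin> Poly_Mapping.keys m" using keys_z[OF that m] by auto
      then show ?thesis by (simp add: not_in_keys_iff_lookup_eq_zero)
    qed
    then show "m \<in> box V D" using keys_z[OF that m] by (simp add: box_def)
  qed
  \<comment> \<open>The space has dimension at most \<open>(l N D + 1) ^ card V\<close>, which is at most
    \<open>N ^ card V * (l D + 1) ^ card V\<close>; \<open>N\<close> is chosen to exceed the second factor.\<close>
  define N where "N = (l * D + 1) ^ card V + 1"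
  define X where "X = {a. set a \<subseteq> {..<N} \<and> length a = l}"
  have "card X = N ^ l" unfolding X_def by (subst card_lists_length_eq) auto
  moreover have "card X \<le> card (box V (l * N * D))"
  proof (rule card_independent_family_le[OF finite_box[OF finV]])
    fix a assume a: "a \<in> X"
    have "set xs \<subseteq> {..<N} \<Longrightarrow> sum_list xs \<le> length xs * N" for xs by (induction xs) auto
    from this[of a] have "sum_list a \<le> l * N" using a by (simp add: X_def)
    then have "sum_list a * D \<le> l * N * D" by (rule mult_right_mono) simp
    moreover have "Poly_Mapping.keys (power_product z a) \<subseteq> box V (sum_list a * D)"
      by (rule keys_power_product_box) (use box_z a in \<open>simp add: X_def\<close>)
    ultimately show "Poly_Mapping.keys (power_product z a) \<subseteq> box V (l * N * D)"
      using box_mono by (meson subset_trans)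
  next
    fix A :: "nat list set" and c :: "nat list \<Rightarrow> 'k"
    assume A: "finite A" "A \<subseteq> X" "\<And>a. a \<in> A \<Longrightarrow> c a \<noteq> 0"
      "(\<Sum>a\<in>A. Poly_Mapping.single 0 (c a) * power_product z a) = 0"
    show "A = {}"
    proof (rule chain_power_products_independent[where P = P and l = l and c = c])
      show "(\<Sum>a\<in>A. Poly_Mapping.single 0 (c a) * power_product z a) \<in> P 0"
        unfolding A(4) by (rule prime_zero[OF prime]) simp
      show "length a = l" if "a \<in> A" for a using that A(2) by (auto simp: X_def)
    qed (use prime strict z A in auto)
  qed
  moreover have "card (box V (l * N * D)) \<le> (l * N * D + 1) ^ card V"
    by (rule card_box_le[OF finV])
  moreover have "(l * N * D + 1) ^ card V \<le> (N * (l * D + 1)) ^ card V"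
    by (intro power_mono) (auto simp: N_def algebra_simps)
  moreover have "(N * (l * D + 1)) ^ card V < N ^ card V * N"
    unfolding power_mult_distrib by (rule mult_strict_left_mono) (simp_all add: N_def)
  moreover have "N ^ Suc (card V) \<le> N ^ l"
    using less by (intro power_increasing) (auto simp: N_def)
  ultimately show False by (simp add: mult.commute)
qed


section \<open>Lexsegments of edges\<close>

lemma lookup_edge:
  "Poly_Mapping.lookup (mon_var a + mon_var b) x = (1 when x = a) + (1 when x = b)"
  by (simp add: mon_var_def lookup_add lookup_single when_def)

lemma edge_less:
  assumes "c < d" and "a < b" and "c < a \<or> c = a \<and> d < b"
  shows "mon_var a + mon_var b < mon_var c + mon_var d"
  unfolding mon_less_iff
  by (rule exI[of _ "if c < a then c else d"]) (use assms in \<open>auto simp: lookup_edge when_def\<close>)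

lemma edge_le_iff:
  assumes "c < d" and "a < b"
  shows "mon_var a + mon_var b \<le> mon_var c + mon_var d \<longleftrightarrow> c < a \<or> c = a \<and> d \<le> b"
proof -
  consider "c < a \<or> c = a \<and> d < b" | "c = a \<and> d = b" | "a < c \<or> a = c \<and> b < d" by linarith
  then show ?thesis
  proof cases
    case 1
    then show ?thesis using edge_less[OF assms 1] by auto
  next
    case 3
    then show ?thesis using edge_less[OF assms(2,1) 3] by auto
  qed auto
qed

lemma edge_squarefree:
  assumes "1 \<le> a" "a < b" "b \<le> n"
  shows "mon_var a + mon_var b \<in> squarefree_monomials n 2"
proof -
  have "Poly_Mapping.keys (mon_var a + mon_var b) \<subseteq> {1..n}"
    using assms by (auto simp: keys_mon_add mon_var_def)
  moreover have "(\<Sum>x = 1..n. Poly_Mapping.lookup (mon_var a + mon_var b) x) = 2"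
    using assms by (simp add: lookup_edge sum.distrib when_def)
  ultimately show ?thesis
    using assms by (auto simp: squarefree_monomials_def monomials_upto_def lookup_edge when_def)
qed

text \<open>For \<open>a < b\<close> the two conditions on \<open>a, b\<close> in the hypothesis \<open>indep\<close> say
  \<open>x\<^sub>1 x\<^sub>i \<ge> x\<^sub>a x\<^sub>b\<close> and \<open>x\<^sub>a x\<^sub>b \<ge> x\<^sub>j x\<^sub>r\<close>, so \<open>V\<close> is an independent set of the edge
  graph.  A vertex strictly between \<open>1\<close> and \<open>j\<close> is joined
  to all vertices but possibly \<open>1\<close>, so it leaves room for two elements at most, and
  \<open>n - j \<ge> 2\<close>.  The vertex \<open>j\<close> excludes \<open>j+1, \<dots>, r\<close>, and when \<open>1 < j\<close> the vertex \<open>1\<close> excludes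
  \<open>i, \<dots>, n\<close>.  When \<open>j = 1\<close> one edge, \<open>{1, i}\<close>, is enough.\<close>

lemma card_independent_le:
  fixes V :: "nat set"
  assumes V: "V \<subseteq> {1..n}"
    and indep: "\<And>a b. a \<in> V \<Longrightarrow> b \<in> V \<Longrightarrow> a < b \<Longrightarrow> 1 < a \<or> 1 = a \<and> i \<le> b \<Longrightarrow>
      a < j \<or> a = j \<and> b \<le> r \<Longrightarrow> False"
    and i: "1 < i" "i \<le> n" and j: "1 \<le> j" "j < r" "r \<le> n" "j + 2 \<le> n"
    and le: "1 < j \<or> 1 = j \<and> i \<le> r"
  shows "card V \<le> n - j"
proof (cases "j = 1")
  case True
  then have "1 \<notin> V \<or> i \<notin> V" using indep[of 1 i] i le by auto
  then have "V \<subset> {1..n}" using V i by auto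
  then have "card V < card {1..n}" by (intro psubset_card_mono) auto
  then show ?thesis using True by simp
next
  case False
  then have "1 < j" using j by simp
  have bound: "card V \<le> m" if "V \<subseteq> B" "finite B" "card B \<le> m" for B m
    using card_mono[OF that(2,1)] that(3) by simp
  have one: "b < i" if "1 \<in> V" "b \<in> V" "1 < b" for b
    using indep[OF that] \<open>1 < j\<close> by (metis not_le)
  consider (below) a where "a \<in> V" "1 < a" "a < j"
    | (at) "j \<in> V" "V \<inter> {1<..<j} = {}"
    | (above) "V \<inter> {1<..j} = {}"
    by (cases "j \<in> V") (auto simp: disjoint_iff le_less)
  then show ?thesis
  proof cases
    case below
    have "V \<subseteq> {1, a}"
    proof
      fix b assume "b \<in> V"
      then show "b \<in> {1, a}"
        using V below indep[of a b] indep[of b a] by (cases a b rule: linorder_cases) force+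
    qed
    then show ?thesis by (rule bound) (use j in \<open>auto simp: card_insert_if\<close>)
  next
    case at
    have far: "b > r" if "b \<in> V" "j < b" for b
      using indep[OF at(1) that] \<open>1 < j\<close> by (metis not_le)
    have shape: "b = 1 \<or> b = j \<or> r < b" if "b \<in> V" for b
      using that at V far[OF that] by (cases b j rule: linorder_cases) force+
    show ?thesis
    proof (cases "1 \<in> V")
      case True
      have "V \<subseteq> {1, j} \<union> {r<..<i}" using shape one[OF True] \<open>1 < j\<close> j by fastforce
      then show ?thesis
        by (rule bound) (use i j in \<open>auto intro!: order.trans[OF card_Un_le] simp: card_insert_if\<close>)
    next
      case False
      have "V \<subseteq> {j} \<union> {r<..n}" using shape False V by fastforce
      then show ?thesis
        by (rule bound) (use j in \<open>auto intro!: order.trans[OF card_Un_le]\<close>)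
    qed
  next
    case above
    have shape: "b = 1 \<or> j < b" if "b \<in> V" for b using that above V by force
    show ?thesis
    proof (cases "1 \<in> V")
      case True
      have "V \<subseteq> {1} \<union> {j<..<i}" using shape one[OF True] \<open>1 < j\<close> by fastforce
      then show ?thesis
        by (rule bound) (use i j in \<open>auto intro!: order.trans[OF card_Un_le]\<close>)
    next
      case False
      have "V \<subseteq> {j<..n}" using shape False V by fastforce
      then show ?thesis by (rule bound) auto
    qed
  qed
qed

lemma poly_of_mon_add: "poly_of_mon (a + b) = poly_of_mon a * poly_of_mon b"
  by (simp add: poly_of_mon_def mult_single)

lemma poly_of_mon_carrier: "poly_of_mon m \<in> carrier (mpoly_ring n) \<longleftrightarrow> m \<in> monomials_upto n"
  by (simp add: poly_of_mon_def mpoly_ring_def)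

lemma variable_in_variable_prime:
  "1 \<le> x \<Longrightarrow> x \<le> n \<Longrightarrow>
    (poly_of_mon (mon_var x) :: ('k::field) mpol) \<in> variable_prime n W \<longleftrightarrow> x \<in> W"
  by (auto simp: variable_prime_def mpoly_ring_def monomials_upto_def kill_eq_0_iff
      poly_of_mon_def mon_var_def)

section \<open>The dimension\<close>

theorem proposition3:
  fixes n i j r :: nat and u v :: mon and I :: "('k::field) mpol set"
  assumes "1 < i" and "i \<le> n"
    and "1 \<le> j" and "j < r" and "r \<le> n"
    and "u = mon_var 1 + mon_var i"
    and "v = mon_var j + mon_var r"
    and "u \<ge> v"
    and "I = lexsegment_edge_ideal n u v"
    and "\<not> initial_lexsegment u"
    and "\<not> final_lexsegment n v"
  shows "krull_dim (mpoly_ring n Quot I) = enat (n - j)"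
proof -
  interpret S: cring "mpoly_ring n :: 'k mpol ring" by (rule cring_mpoly_ring)
  let ?G = "poly_of_mon ` lexsegment n u v :: 'k mpol set"
  have G: "?G \<subseteq> carrier (mpoly_ring n)"
    by (auto simp: poly_of_mon_carrier lexsegment_def squarefree_monomials_def)
  have I: "ideal I (mpoly_ring n)" "?G \<subseteq> I"
    using S.genideal_ideal[OF G] S.genideal_self[OF G] assms(9) by (auto simp: lexsegment_edge_ideal_def)
  \<comment> \<open>\<open>j = n - 1\<close> would force \<open>r = n\<close> and make the segment final\<close>
  have jn: "j + 2 \<le> n"
  proof (rule ccontr)
    assume "\<not> j + 2 \<le> n"
    then have "j = n - 1" "r = n" using assms(4,5) by auto
    then show False using assms(7,11) by (simp add: final_lexsegment_def)
  qed
  let ?L = "{l. \<exists>P. (\<forall>k\<le>l. primeideal (P k) (mpoly_ring n) \<and> I \<subseteq> P k) \<and> (\<forall>k<l. P k \<subset> P (Suc k))}"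
  have upper: "l \<le> n - j" if "l \<in> ?L" for l
  proof -
    obtain P where P: "\<And>k. k \<le> l \<Longrightarrow> primeideal (P k) (mpoly_ring n)" "I \<subseteq> P 0"
      and strict: "\<And>k. k < l \<Longrightarrow> P k \<subset> P (Suc k)" using \<open>l \<in> ?L\<close> by auto
    define V where "V = {x \<in> {1..n}. poly_of_mon (mon_var x) \<notin> P 0}"
    have "l \<le> card V"
      by (rule chain_length_le[where P = P and n = n]) (use P strict in \<open>auto simp: V_def\<close>)
    also have "\<dots> \<le> n - j"
    proof (rule card_independent_le[where i = i and r = r])
      show "V \<subseteq> {1..n}" by (auto simp: V_def)
      show "1 < j \<or> 1 = j \<and> i \<le> r"
        using assms(8) unfolding assms(6,7) edge_le_iff[OF assms(1,4)] .
      fix a b assume ab: "a \<in> V" "b \<in> V" "a < b" "1 < a \<or> 1 = a \<and> i \<le> b" "a < j \<or> a = j \<and> b \<le> r"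
      then have n: "a \<in> {1..n}" "b \<in> {1..n}" by (auto simp: V_def)
      have "v \<le> mon_var a + mon_var b" "mon_var a + mon_var b \<le> u"
        unfolding assms(6,7) edge_le_iff[OF ab(3) assms(4)] edge_le_iff[OF assms(1) ab(3)]
        using ab(4,5) by auto
      then have "mon_var a + mon_var b \<in> lexsegment n u v"
        using edge_squarefree[OF _ ab(3)] n by (simp add: lexsegment_def)
      then have "poly_of_mon (mon_var a) * poly_of_mon (mon_var b) \<in> P 0"
        using I(2) P(2) by (force simp flip: poly_of_mon_add)
      moreover have "(poly_of_mon (mon_var x) :: 'k mpol) \<in> carrier (mpoly_ring n)" if "x \<in> {1..n}" for x
        using that by (simp add: poly_of_mon_carrier monomials_upto_def mon_var_def)
      ultimately have "poly_of_mon (mon_var a) \<in> P 0 \<or> poly_of_mon (mon_var b) \<in> P 0"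
        using prime_cancel[OF P(1)[of 0]] n by blast
      then show False using ab(1,2) by (auto simp: V_def)
    qed (use assms jn in auto)
    finally show ?thesis .
  qed
  have lower: "n - j \<in> ?L"
  proof -
    define P where "P = (\<lambda>k. variable_prime n {1..j + k} :: 'k mpol set)"
    have "I \<subseteq> P k" for k
      unfolding assms(9) lexsegment_edge_ideal_def
    proof (rule S.genideal_minimal)
      show "ideal (P k) (mpoly_ring n)"
        unfolding P_def by (rule primeideal.axioms(1)[OF primeideal_variable_prime])
      show "?G \<subseteq> P k"
      proof clarify
        fix w assume w: "w \<in> lexsegment n u v"
        have keys: "Poly_Mapping.keys w \<subseteq> {1..n}"
          using w by (auto simp: lexsegment_def squarefree_monomials_def monomials_upto_def)
        have vj: "0 < Poly_Mapping.lookup v j" by (simp add: assms(7) lookup_edge)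
        have "v \<le> w" using w by (simp add: lexsegment_def)
        \<comment> \<open>if \<open>w\<close> first differs from \<open>v\<close> at an index beyond \<open>j\<close>, it shares the factor \<open>x\<^sub>j\<close> with \<open>v\<close>\<close>
        then have "v = w \<or> v < w" by auto
        then have "\<exists>x\<le>j. 0 < Poly_Mapping.lookup w x"
        proof
          assume "v < w"
          then obtain x where x: "Poly_Mapping.lookup v x < Poly_Mapping.lookup w x"
            "\<And>y. y < x \<Longrightarrow> Poly_Mapping.lookup v y = Poly_Mapping.lookup w y"
            by (auto simp: mon_less_iff)
          show ?thesis
          proof (cases "x \<le> j")
            case True
            then show ?thesis using x(1) by auto
          next
            case False
            then show ?thesis using x(2)[of j] vj by auto
          qed
        qed (use vj in auto)
        then obtain x where "x \<le> j" "x \<in> Poly_Mapping.keys w" by (auto simp: in_keys_iff)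
        then have "Poly_Mapping.keys w \<inter> {1..j + k} \<noteq> {}" using keys by force
        then show "poly_of_mon w \<in> P k"
          using keys by (simp add: P_def variable_prime_def poly_of_mon_carrier monomials_upto_def
              kill_eq_0_iff poly_of_mon_def mpoly_ring_def)
      qed
    qed
    moreover have "P k \<subset> P (Suc k)" if "k < n - j" for k
    proof
      show "P k \<subseteq> P (Suc k)"
        by (force simp: P_def variable_prime_def kill_eq_0_iff)
      have "poly_of_mon (mon_var (j + Suc k)) \<in> P (Suc k) - P k"
        using that by (simp add: P_def variable_in_variable_prime)
      then show "P k \<noteq> P (Suc k)" by blast
    qed
    moreover have "primeideal (P k) (mpoly_ring n)" for k
      unfolding P_def by (rule primeideal_variable_prime)
    ultimately show ?thesis by blast
  qed
  show ?thesis
    unfolding S.krull_dim_Quot[OF I(1)]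
    by (rule antisym[OF SUP_least SUP_upper[OF lower]]) (use upper in auto)
qed

end
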